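(* Let $p$ be a prime and let $A\in SL_2(\mathbb F_p)$ be semisimple and diagonalizable over $\mathbb F_p$, with eigenvalues $\lambda_1,\lambda_2$ satisfying $\left(\frac{\lambda_1}{p}\right)=\left(\frac{\lambda_2}{p}\right)=-1$. Then a square root of $A$ exists in $SL_2(\mathbb F_p)$ (i.e. there is $B\in SL_2(\mathbb F_p)$ with $B^2=A$) if and only if $A$ is similar to a scalar matrix.
   Context: For $a\in\mathbb F_p$, $\left(\frac{a}{p}\right)=-1$ means that $a$ is not a square in $\mathbb F_p$. *)

theory Defs
  imports
    "Jordan_Normal_Form.Spectral_Radius"
    "Berlekamp_Zassenhaus.Finite_Field"
    "HOL-Computational_Algebra.Nth_Powers"
    "HOL-Algebra.Algebraic_Closure_Type"
begin

text \<open>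
  For a type \<open>'p\<close> of class \<open>prime_card\<close>, with \<open>p = CARD('p)\<close>, the type \<open>'p mod_ring\<close>
  is the prime field with \<open>p\<close> elements. Letting \<open>'p\<close> range over all such types amounts
  to letting \<open>p\<close> range over all primes, including \<open>p = 2\<close>.
\<close>

definition SL :: "nat \<Rightarrow> 'a :: comm_ring_1 mat set" where
  "SL n = {A \<in> carrier_mat n n. det A = 1}"

definition diagonalizable :: "'a :: field mat \<Rightarrow> bool" where
  "diagonalizable A \<longleftrightarrow> (\<exists>D. diagonal_mat D \<and> similar_mat A D)"

text \<open>Semisimple means diagonalizable over an algebraic closure; \<open>to_ac\<close> embeds a field into its closure.\<close>

definition semisimple :: "'a :: field mat \<Rightarrow> bool" where
  "semisimple A \<longleftrightarrow> diagonalizable (map_mat to_ac A)"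

definition scalar_mat :: "'a :: field mat \<Rightarrow> bool" where
  "scalar_mat S \<longleftrightarrow> (\<exists>n c. S = c \<cdot>\<^sub>m 1\<^sub>m n)"

end

theory Submission
  imports Defs
begin

text \<open>
  The Cayley-Hamilton identity decides everything. If \<open>B\<close> has determinant \<open>1\<close> and trace \<open>t\<close>, then
  \<open>B\<^sup>2 = t B - I\<close>. When \<open>t\<close> is nonzero, \<open>B\<close> is therefore an affine function of \<open>B\<^sup>2\<close>, so every
  eigenvector of \<open>B\<^sup>2\<close> is already an eigenvector of \<open>B\<close>, and the corresponding eigenvalue of \<open>B\<^sup>2\<close>
  is the square of one of \<open>B\<close> (\<open>eigenvalue_of_square_is_square\<close>). Nonsquare eigenvalues of
  \<open>A = B\<^sup>2\<close> thus force \<open>t = 0\<close>, and then \<open>A = -I\<close>.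

  Conversely, a matrix similar to a scalar matrix is that scalar matrix, \<open>A = c I\<close>. Determinant \<open>1\<close>
  gives \<open>c\<^sup>2 = 1\<close>, and \<open>c\<close>, being the eigenvalue, is not the square \<open>1\<close>; hence \<open>c = -1\<close>. The rotation
  by a right angle is a square root of \<open>-I\<close> with determinant \<open>1\<close>.
\<close>

lemma pow_mat_2:
  fixes B :: "'a :: comm_ring_1 mat"
  assumes "B \<in> carrier_mat n n"
  shows "B ^\<^sub>m 2 = B * B"
  using assms by (simp add: numeral_2_eq_2)

lemma det_2:
  fixes A :: "'a :: comm_ring_1 mat"
  assumes "A \<in> carrier_mat 2 2"
  shows "det A = A $$ (0,0) * A $$ (1,1) - A $$ (0,1) * A $$ (1,0)"
proof -
  have "det A = (\<Sum>j<2. A $$ (0,j) * cofactor A 0 j)"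
    by (rule laplace_expansion_row[OF assms]) simp
  moreover have "det (mat_delete A 0 j) = A $$ (1, 1 - j)" if "j < 2" for j
  proof -
    have "mat_delete A 0 j \<in> carrier_mat 1 1"
      using mat_delete_carrier[OF assms] by simp
    then show ?thesis
      using that assms by (subst det_single) (auto simp: mat_delete_def less_2_cases_iff)
  qed
  ultimately show ?thesis
    by (simp add: cofactor_def numeral_2_eq_2)
qed

lemma smult_mat_mult_vec:
  fixes B :: "'a :: comm_ring_1 mat"
  assumes "B \<in> carrier_mat nr nc" and "v \<in> carrier_vec nc"
  shows "(c \<cdot>\<^sub>m B) *\<^sub>v v = c \<cdot>\<^sub>v (B *\<^sub>v v)"
  using assms by (intro eq_vecI) (auto simp: scalar_prod_def sum_distrib_left mult.assoc)

lemma SL2_Cayley_Hamilton: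
  fixes B :: "'a :: comm_ring_1 mat"
  assumes "B \<in> SL 2"
  shows "B * B = (B $$ (0,0) + B $$ (1,1)) \<cdot>\<^sub>m B - 1\<^sub>m 2"
proof -
  have B: "B \<in> carrier_mat 2 2" and "det B = 1"
    using assms by (auto simp: SL_def)
  then have "B $$ (0,0) * B $$ (1,1) = 1 + B $$ (0,1) * B $$ (1,0)"
    by (simp add: det_2 algebra_simps)
  then show ?thesis
    using B by (intro eq_matI)
      (auto simp: scalar_prod_def less_Suc_eq numeral_2_eq_2 algebra_simps)
qed

text \<open>
  For an eigenvector \<open>v\<close> of \<open>B\<^sup>2 = t B - I\<close> with eigenvalue \<open>l\<close>, the identity gives
  \<open>t B v = (l + 1) v\<close>. Dividing by the trace \<open>t\<close> exhibits \<open>(l + 1) / t\<close> as a square root of \<open>l\<close>,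
  because \<open>B v = ((l + 1) / t) v\<close> forces \<open>B\<^sup>2 v = ((l + 1) / t)\<^sup>2 v\<close>.
\<close>

lemma eigenvalue_of_square_is_square:
  fixes B :: "'a :: field mat"
  assumes "B \<in> SL 2" and "B $$ (0,0) + B $$ (1,1) \<noteq> 0" and "eigenvalue (B * B) l"
  shows "is_square l"
proof -
  define t where "t = B $$ (0,0) + B $$ (1,1)"
  have t: "t \<noteq> 0" using assms(2) by (simp add: t_def)
  have B: "B \<in> carrier_mat 2 2" using assms(1) by (auto simp: SL_def)
  obtain v where v: "v \<in> carrier_vec 2" "v \<noteq> 0\<^sub>v 2" "(B * B) *\<^sub>v v = l \<cdot>\<^sub>v v"
    using assms(3) B by (auto simp: eigenvalue_def eigenvector_def)
  have "t \<cdot>\<^sub>v (B *\<^sub>v v) - v = l \<cdot>\<^sub>v v"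
  proof -
    have "(t \<cdot>\<^sub>m B - 1\<^sub>m 2) *\<^sub>v v = (t \<cdot>\<^sub>m B) *\<^sub>v v - 1\<^sub>m 2 *\<^sub>v v"
      using B v(1) by (intro minus_mult_distrib_mat_vec) auto
    also have "\<dots> = t \<cdot>\<^sub>v (B *\<^sub>v v) - v"
      using B v(1) by (auto simp: smult_mat_mult_vec)
    finally show ?thesis
      using v(3) SL2_Cayley_Hamilton[OF assms(1)] by (simp add: t_def)
  qed
  then have *: "t * (B *\<^sub>v v) $ i - v $ i = l * v $ i" if "i < 2" for i
    using that B v(1) by (auto dest!: arg_cong[where f = "\<lambda>w. vec_index w i"] simp del: index_mult_mat_vec)
  define m where "m = (l + 1) / t"
  have Bv: "B *\<^sub>v v = m \<cdot>\<^sub>v v"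
  proof (rule eq_vecI)
    fix i assume "i < dim_vec (m \<cdot>\<^sub>v v)"
    then have i: "i < 2" using v(1) by simp
    have "t * (B *\<^sub>v v) $ i = (l + 1) * v $ i"
      using *[OF i] by (simp add: algebra_simps)
    then have "(B *\<^sub>v v) $ i = m * v $ i"
      using t by (simp add: m_def field_simps del: index_mult_mat_vec)
    then show "(B *\<^sub>v v) $ i = (m \<cdot>\<^sub>v v) $ i"
      using i v(1) by (simp del: index_mult_mat_vec)
  qed (use B v(1) in auto)
  have "l \<cdot>\<^sub>v v = B *\<^sub>v (B *\<^sub>v v)"
    using v B by (metis assoc_mult_mat_vec)
  also have "\<dots> = m \<cdot>\<^sub>v (m \<cdot>\<^sub>v v)"
    using B v(1) by (simp add: Bv mult_mat_vec)
  finally have eq: "l * v $ i = m * (m * v $ i)" if "i < 2" for i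
    using that v(1) by (auto dest!: arg_cong[where f = "\<lambda>w. vec_index w i"])
  obtain i where "i < 2" "v $ i \<noteq> 0"
    using v(1,2) by (metis eq_vecI carrier_vecD index_zero_vec)
  with eq[of i] have "l = m ^ 2"
    by (simp add: power2_eq_square flip: mult.assoc)
  then show ?thesis by (auto simp: is_nth_power_def)
qed

lemma similar_mat_scalarD:
  fixes A :: "'a :: field mat"
  assumes "A \<in> carrier_mat n n" and "scalar_mat S" and "similar_mat A S"
  obtains c where "A = c \<cdot>\<^sub>m 1\<^sub>m n"
proof -
  obtain P Q where "similar_mat_wit A S P Q"
    using assms(3) by (auto simp: similar_mat_def)
  note w = similar_mat_witD2[OF assms(1) this]
  obtain c where "S = c \<cdot>\<^sub>m 1\<^sub>m n"
    using assms(2) w(5) by (auto simp: scalar_mat_def)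
  then have "A = (c \<cdot>\<^sub>m P) * Q"
    using w by (simp add: mult_smult_distrib[of _ n n _ n])
  also have "\<dots> = c \<cdot>\<^sub>m 1\<^sub>m n"
    using w by (auto simp: mult_smult_assoc_mat[of _ n n _ n])
  finally show thesis by (rule that)
qed

lemma eigenvalue_scalar:
  fixes c :: "'a :: field"
  assumes "eigenvalue (c \<cdot>\<^sub>m 1\<^sub>m n) l"
  shows "l = c"
proof -
  obtain v where v: "v \<in> carrier_vec n" "v \<noteq> 0\<^sub>v n" "(c \<cdot>\<^sub>m 1\<^sub>m n) *\<^sub>v v = l \<cdot>\<^sub>v v"
    using assms by (auto simp: eigenvalue_def eigenvector_def)
  have "c \<cdot>\<^sub>v v = l \<cdot>\<^sub>v v"
    using v by (metis smult_mat_mult_vec one_carrier_mat one_mult_mat_vec)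
  then have eq: "c * v $ i = l * v $ i" if "i < n" for i
    using that v(1) by (auto dest!: arg_cong[where f = "\<lambda>w. vec_index w i"])
  obtain i where "i < n" "v $ i \<noteq> 0"
    using v(1,2) by (metis eq_vecI carrier_vecD index_zero_vec)
  with eq[of i] show ?thesis by simp
qed

lemma minus_one_has_root_in_SL2:
  "\<exists>B \<in> SL 2. B * B = (- 1 :: 'a :: comm_ring_1) \<cdot>\<^sub>m 1\<^sub>m 2"
proof -
  define B :: "'a mat" where "B = mat 2 2 (\<lambda>(i, j). if i = j then 0 else if i = 0 then 1 else - 1)"
  have "B \<in> carrier_mat 2 2" by (simp add: B_def)
  moreover have "det B = 1" by (subst det_2) (auto simp: B_def)
  ultimately have B: "B \<in> SL 2" by (simp add: SL_def)
  \<comment> \<open>The trace vanishes, so the Cayley-Hamilton identity reads \<open>B\<^sup>2 = -I\<close>.\<close>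
  have "B * B = (- 1) \<cdot>\<^sub>m 1\<^sub>m 2"
    unfolding SL2_Cayley_Hamilton[OF B] by (intro eq_matI) (auto simp: B_def)
  with B show ?thesis by blast
qed

theorem theorem32:
  fixes A :: "'p :: prime_card mod_ring mat"
    and l\<^sub>1 l\<^sub>2 :: "'p mod_ring"
  assumes "A \<in> SL 2"
    and "semisimple A"
    and "diagonalizable A"
    and "spectrum A = {l\<^sub>1, l\<^sub>2}"
    and "\<not> is_square l\<^sub>1"
    and "\<not> is_square l\<^sub>2"
  shows "(\<exists>B \<in> SL 2. B ^\<^sub>m 2 = A) \<longleftrightarrow> (\<exists>S. scalar_mat S \<and> similar_mat A S)"
proof -
  have A: "A \<in> carrier_mat 2 2" "det A = 1"
    using assms(1) by (auto simp: SL_def)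
  have ev: "eigenvalue A l\<^sub>1"
    using assms(4) by (auto simp: spectrum_def)
  show ?thesis
  proof
    assume "\<exists>B \<in> SL 2. B ^\<^sub>m 2 = A"
    then obtain B where SL: "B \<in> SL 2" and "B ^\<^sub>m 2 = A" by blast
    then have B: "B \<in> carrier_mat 2 2" and BB: "B * B = A"
      by (auto simp: SL_def pow_mat_2)
    have "B $$ (0,0) + B $$ (1,1) = 0"
      using eigenvalue_of_square_is_square[OF SL] ev assms(5) BB by blast
    then have "A = (- 1) \<cdot>\<^sub>m 1\<^sub>m 2"
      unfolding BB[symmetric] SL2_Cayley_Hamilton[OF SL] using B by (intro eq_matI) auto
    then have "scalar_mat A" by (auto simp: scalar_mat_def)
    then show "\<exists>S. scalar_mat S \<and> similar_mat A S"
      using similar_mat_refl[OF A(1)] by blast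
  next
    assume "\<exists>S. scalar_mat S \<and> similar_mat A S"
    then obtain c where c: "A = c \<cdot>\<^sub>m 1\<^sub>m 2"
      using similar_mat_scalarD[OF A(1)] by blast
    have "c * c = 1"
      using A by (simp add: c power2_eq_square)
    moreover have "c \<noteq> 1"
      using eigenvalue_scalar ev assms(5) unfolding c by fastforce
    ultimately have "c = - 1"
      by (simp add: square_eq_1_iff)
    then obtain B where "B \<in> SL 2" "B * B = A"
      using minus_one_has_root_in_SL2 c by blast
    then show "\<exists>B \<in> SL 2. B ^\<^sub>m 2 = A"
      by (intro bexI[of _ B]) (auto simp: SL_def pow_mat_2)
  qed
qed

end
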